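(* For every integer $n \geq 10$ such that $n = 12$ or $n \bmod 18 \notin \{6,12\}$, it holds that $\mathrm{WL}_1(n) = n-1$.
   Context: All graphs are finite, simple and undirected. Colour Refinement on a graph $G$ (with monochromatic initial colouring) computes colourings $\chi^i_G$: $\chi^0_G$ is constant, and for $i \geq 1$, $\chi^i_G(v) = \big(\chi^{i-1}_G(v), \{\!\{\chi^{i-1}_G(w) \mid w \in N(v)\}\!\}\big)$, where $N(v)$ is the neighbourhood of $v$ and $\{\!\{\cdot\}\!\}$ denotes a multiset. Let $\pi^i_G$ be the partition of $V(G)$ into colour classes of $\chi^i_G$. $\mathrm{WL}_1(G)$ is the least $j \geq 0$ such that $\pi^j_G = \pi^{j+1}_G$ (the number of iterations until stabilisation), and for $n \in \mathbb{N}$, $\mathrm{WL}_1(n)$ is the maximum of $\mathrm{WL}_1(G)$ over all graphs $G$ with $n$ vertices. *)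

theory Defs
  imports "HOL-Library.Multiset" "Graph_Theory.Pair_Digraph"
begin

text \<open>
  Finite simple undirected graphs are the \<^locale>\<open>pair_graph\<close>s of Graph_Theory: finite, loop-free,
  with a symmetric arc relation, so an undirected edge is a pair of opposite arcs.
\<close>

definition neighbourhood :: "'a pair_pre_digraph \<Rightarrow> 'a \<Rightarrow> 'a set" where
  "neighbourhood G v = {w. (v, w) \<in> parcs G}"

text \<open>
  The colours of all rounds live in one type. \<open>Refined c M\<close> stands for the pair \<open>(c, M)\<close>; a datatype
  is needed since the pairs are nested to a depth that grows with the round.
\<close>

datatype colour = Initial | Refined colour "colour multiset"

primrec colouring :: "'a pair_pre_digraph \<Rightarrow> nat \<Rightarrow> 'a \<Rightarrow> colour" where
  "colouring G 0 v = Initial"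
| "colouring G (Suc i) v =
     Refined (colouring G i v) (image_mset (colouring G i) (mset_set (neighbourhood G v)))"

definition colour_partition :: "'a pair_pre_digraph \<Rightarrow> nat \<Rightarrow> 'a set set" where
  "colour_partition G i =
     pverts G // {(u, v) \<in> pverts G \<times> pverts G. colouring G i u = colouring G i v}"

definition WL1 :: "'a pair_pre_digraph \<Rightarrow> nat" where
  "WL1 G = (LEAST j. colour_partition G j = colour_partition G (Suc j))"

text \<open>
  Every finite graph is isomorphic to one whose vertices are natural numbers, so these represent all
  graphs on \<open>n\<close> vertices. There are infinitely many of them, but only finitely many values of
  \<^const>\<open>WL1\<close> (at most \<open>n - 1\<close> for \<open>n > 0\<close>, since every round before stabilisation adds a colour
  class), so \<^const>\<open>Max\<close> is meaningful.
\<close>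

definition WL1_max :: "nat \<Rightarrow> nat" where
  "WL1_max n = Max {WL1 G | G :: nat pair_pre_digraph. pair_graph G \<and> card (pverts G) = n}"

end

theory Submission
  imports Defs
begin

text \<open>
  The key is a family of graphs made of three arms \<open>A\<close>, \<open>B\<close>, \<open>C\<close>, each a path of pairs of vertices
  in which consecutive pairs are joined by a perfect matching. The levels of the arms are first
  recognised one after the other, in parallel on the three arms. At the top, one round tells \<open>A\<close> from
  the two others, and this difference runs down to level \<open>0\<close>. There \<open>A\<close> is joined to \<open>B\<close> but not to
  \<open>C\<close>, so that the difference between \<open>B\<close> and \<open>C\<close> runs up again. The top pair of \<open>A\<close> has one vertex
  joined to a pair on \<open>B\<close> and one joined to the corresponding pair on \<open>C\<close>, so it is the first pair to
  be split, and then the splitting runs along \<open>A\<close>, \<open>B\<close> and \<open>C\<close>, one pair per round. Each round thus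
  creates exactly one new class.

  Four variants of the gadgets at the two ends cover the orders congruent to \<open>1\<close>, \<open>2\<close>, \<open>4\<close>, \<open>5\<close>
  modulo \<open>6\<close>. All of them have two consecutive degrees, so a new vertex that is joined to all vertices
  of the smaller degree costs one further round, which covers the orders congruent to \<open>3\<close> and \<open>0\<close>.
  Together with a single graph on \<open>10\<close> vertices this settles every order from \<open>10\<close> on.
\<close>

section \<open>Colour Refinement in general\<close>

lemma pair_graph_iff:
  "pair_graph G \<longleftrightarrow>
     finite (pverts G) \<and> parcs G \<subseteq> pverts G \<times> pverts G \<and> sym (parcs G) \<and> irrefl (parcs G)"
proof
  assume "pair_graph G"
  then interpret pair_graph G .
  show "finite (pverts G) \<and> parcs G \<subseteq> pverts G \<times> pverts G \<and> sym (parcs G) \<and> irrefl (parcs G)"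
    using pair_finite_verts arcs_symmetric no_loops'
    by (auto simp: sym_def irrefl_def dest: in_arcsD1 in_arcsD2)
next
  assume *: "finite (pverts G) \<and> parcs G \<subseteq> pverts G \<times> pverts G \<and> sym (parcs G) \<and> irrefl (parcs G)"
  then have "finite (parcs G)"
    by (meson finite_SigmaI finite_subset)
  with * show "pair_graph G"
    by unfold_locales (auto simp: symmetric_def irrefl_def)
qed

lemma
  assumes "pair_graph G"
  shows finite_pverts: "finite (pverts G)"
    and neighbourhood_subset: "neighbourhood G v \<subseteq> pverts G"
    and finite_neighbourhood: "finite (neighbourhood G v)"
    and set_mset_neighbourhood: "set_mset (mset_set (neighbourhood G v)) \<subseteq> pverts G"
proof -
  show *: "finite (pverts G)" and "neighbourhood G v \<subseteq> pverts G"
    using assms by (auto simp: pair_graph_iff neighbourhood_def)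
  then show "finite (neighbourhood G v)"
    by (metis finite_subset)
  then show "set_mset (mset_set (neighbourhood G v)) \<subseteq> pverts G"
    using \<open>neighbourhood G v \<subseteq> pverts G\<close> by simp
qed

text \<open>On \<open>V\<close> each of \<open>f\<close> and \<open>g\<close> factors through the
  other, so comparing multisets of colours depends only on which colours agree, not on their
  names.\<close>

lemma image_mset_eq_iff_kernel:
  assumes ker: "\<And>x y. x \<in> V \<Longrightarrow> y \<in> V \<Longrightarrow> f x = f y \<longleftrightarrow> g x = g y"
    and "set_mset M \<subseteq> V" "set_mset N \<subseteq> V"
  shows "image_mset f M = image_mset f N \<longleftrightarrow> image_mset g M = image_mset g N"
proof -
  have factor: "image_mset g' M = image_mset g' N"
    if "\<And>x y. x \<in> V \<Longrightarrow> y \<in> V \<Longrightarrow> f' x = f' y \<longleftrightarrow> g' x = g' y"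
      and "image_mset f' M = image_mset f' N"
    for f' :: "'a \<Rightarrow> 'd" and g' :: "'a \<Rightarrow> 'e"
  proof -
    define h where "h = g' \<circ> inv_into V f'"
    have "g' x = h (f' x)" if "x \<in> V" for x
      using that \<open>\<And>x y. x \<in> V \<Longrightarrow> y \<in> V \<Longrightarrow> f' x = f' y \<longleftrightarrow> g' x = g' y\<close>
      by (metis comp_apply f_inv_into_f h_def image_eqI inv_into_into)
    then have "image_mset g' K = image_mset h (image_mset f' K)" if "set_mset K \<subseteq> V" for K
      using that by (auto simp: image_mset.compositionality intro!: image_mset_cong)
    then show ?thesis
      using assms(2,3) that(2) by simp
  qed
  show ?thesis
    using factor[of f g] factor[of g f] ker by blast
qed

lemma colouring_SucD: "colouring G (Suc i) u = colouring G (Suc i) v \<Longrightarrow> colouring G i u = colouring G i v"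
  by simp

text \<open>An equivalence relation can be read off from its quotient: two elements are related iff
  some class contains both.\<close>

lemma colour_partition_eq_iff:
  "colour_partition G i = colour_partition G' j \<longleftrightarrow>
     (\<forall>u\<in>V. \<forall>v\<in>V. colouring G i u = colouring G i v \<longleftrightarrow> colouring G' j u = colouring G' j v)"
  if "pverts G = V" "pverts G' = V"
proof -
  define R where "R = {(u, v) \<in> V \<times> V. colouring G i u = colouring G i v}"
  define S where "S = {(u, v) \<in> V \<times> V. colouring G' j u = colouring G' j v}"
  have mem: "(u, v) \<in> T \<longleftrightarrow> (\<exists>X \<in> V // T. u \<in> X \<and> v \<in> X)" if T: "equiv V T" for T u v
  proof
    assume uv: "(u, v) \<in> T"
    then have "u \<in> V" "v \<in> T `` {u}" "u \<in> T `` {u}"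
      using T by (auto simp: equiv_def refl_on_def)
    then show "\<exists>X \<in> V // T. u \<in> X \<and> v \<in> X"
      using quotientI by metis
  next
    assume "\<exists>X \<in> V // T. u \<in> X \<and> v \<in> X"
    then show "(u, v) \<in> T"
      using quotient_eq_iff[OF T] by blast
  qed
  have "equiv V R" "equiv V S"
    by (auto simp: R_def S_def equiv_def refl_on_def sym_def trans_def)
  then have "V // R = V // S \<longleftrightarrow> R = S"
    using mem[of R] mem[of S] by auto
  also have "\<dots> \<longleftrightarrow> (\<forall>u\<in>V. \<forall>v\<in>V. colouring G i u = colouring G i v \<longleftrightarrow> colouring G' j u = colouring G' j v)"
    by (auto simp: R_def S_def set_eq_iff)
  finally show ?thesis
    using that by (simp add: colour_partition_def R_def S_def)
qed

text \<open>Each partition determines the next one, since neighbourhood multisets are compared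
  through the kernel of the colouring only. A single repetition therefore persists.\<close>

lemma colour_partition_stable:
  assumes "pair_graph G" "colour_partition G i = colour_partition G (Suc i)" "i \<le> j"
  shows "colour_partition G j = colour_partition G (Suc j)"
  using assms(3)
proof (induction rule: dec_induct)
  case base
  show ?case by fact
next
  case (step j)
  note IH = step.IH[unfolded colour_partition_eq_iff[OF refl refl]]
  have "image_mset (colouring G j) (mset_set (neighbourhood G u)) =
          image_mset (colouring G j) (mset_set (neighbourhood G v)) \<longleftrightarrow>
        image_mset (colouring G (Suc j)) (mset_set (neighbourhood G u)) =
          image_mset (colouring G (Suc j)) (mset_set (neighbourhood G v))" for u v
    using set_mset_neighbourhood[OF assms(1)] IH
    by (intro image_mset_eq_iff_kernel[where V = "pverts G"]) blast+
  with IH show ?case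
    unfolding colour_partition_eq_iff[OF refl refl] colouring.simps(2)[of G "Suc j"]
      colouring.simps(2)[of G j] colour.inject by blast
qed

text \<open>Forgetting the last round maps the new colours onto the old ones. If this map were
  injective, the partition would not have changed, so every round before stabilisation gains a
  colour.\<close>

lemma card_colours_ge:
  assumes "pair_graph G" "pverts G \<noteq> {}"
    and "\<And>j. j < i \<Longrightarrow> colour_partition G j \<noteq> colour_partition G (Suc j)"
  shows "Suc i \<le> card (colouring G i ` pverts G)"
  using assms(3)
proof (induction i)
  case 0
  then show ?case
    using assms(2) finite_pverts[OF assms(1)] by (simp add: Suc_le_eq card_gt_0_iff)
next
  case (Suc i)
  \<comment> \<open>The value at \<open>Initial\<close> is a dummy: \<open>p\<close> is applied only
    to colours of round \<open>Suc i\<close>.\<close>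
  define p where "p = (\<lambda>c. case c of Refined c' M \<Rightarrow> c' | Initial \<Rightarrow> Initial)"
  let ?V = "pverts G"
  have fin: "finite (colouring G (Suc i) ` ?V)"
    using finite_pverts[OF assms(1)] by blast
  have proj: "p (colouring G (Suc i) v) = colouring G i v" for v
    by (simp add: p_def)
  have image: "colouring G i ` ?V = p ` colouring G (Suc i) ` ?V"
    unfolding image_image proj ..
  have "card (p ` colouring G (Suc i) ` ?V) < card (colouring G (Suc i) ` ?V)"
  proof (rule ccontr)
    assume "\<not> ?thesis"
    then have "inj_on p (colouring G (Suc i) ` ?V)"
      using fin by (simp add: card_image_le eq_card_imp_inj_on le_antisym)
    then have "colouring G (Suc i) u = colouring G (Suc i) v"
      if "u \<in> ?V" "v \<in> ?V" "colouring G i u = colouring G i v" for u v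
      using that by (metis image_eqI inj_onD proj)
    then have "colour_partition G i = colour_partition G (Suc i)"
      unfolding colour_partition_eq_iff[OF refl refl] by (meson colouring_SucD[of G i])
    then show False
      using Suc.prems by blast
  qed
  moreover have "Suc i \<le> card (colouring G i ` ?V)"
    using Suc by simp
  ultimately show ?case
    by (simp add: image)
qed

lemma stabilises_before_card:
  assumes "pair_graph G" "pverts G \<noteq> {}"
  shows "\<exists>j < card (pverts G). colour_partition G j = colour_partition G (Suc j)"
proof (rule ccontr)
  assume "\<not> ?thesis"
  then have "Suc (card (pverts G)) \<le> card (colouring G (card (pverts G)) ` pverts G)"
    by (intro card_colours_ge[OF assms]) blast
  then show False
    using card_image_le[OF finite_pverts[OF assms(1)], of "colouring G (card (pverts G))"] by simp
qed

lemma WL1_less_card: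
  assumes "pair_graph G" "pverts G \<noteq> {}"
  shows "WL1 G < card (pverts G)"
proof -
  obtain j where "j < card (pverts G)" "colour_partition G j = colour_partition G (Suc j)"
    using stabilises_before_card[OF assms] by blast
  then show ?thesis
    unfolding WL1_def by (metis (mono_tags, lifting) Least_le le_less_trans)
qed

text \<open>Round \<open>i\<close> is not stable, and since stability persists, no earlier round is
  stable either.\<close>

lemma WL1_greater:
  assumes "pair_graph G" "u \<in> pverts G" "v \<in> pverts G"
    and "colouring G i u = colouring G i v" "colouring G (Suc i) u \<noteq> colouring G (Suc i) v"
  shows "i < WL1 G"
proof (rule ccontr)
  assume "\<not> i < WL1 G"
  moreover have "colour_partition G (WL1 G) = colour_partition G (Suc (WL1 G))"
  proof -
    obtain j where "colour_partition G j = colour_partition G (Suc j)"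
      using stabilises_before_card[OF assms(1)] assms(2) by blast
    then show ?thesis
      unfolding WL1_def by (rule LeastI)
  qed
  ultimately have "colour_partition G i = colour_partition G (Suc i)"
    using colour_partition_stable[OF assms(1), of "WL1 G" i] by linarith
  then show False
    using assms(2-5) by (auto simp: colour_partition_eq_iff[OF refl refl])
qed

section \<open>Graphs attaining the general upper bound\<close>

definition long_refinement :: "nat \<Rightarrow> 'a pair_pre_digraph \<Rightarrow> bool" where
  "long_refinement n G \<longleftrightarrow> pair_graph G \<and> card (pverts G) = n \<and> WL1 G = n - 1"

text \<open>The upper bound holds for every nonempty graph, so one pair of vertices first separated
  in round \<open>n - 1\<close> suffices; here \<open>n\<close> is \<open>i + 2\<close>.\<close>

lemma long_refinementI:
  assumes "pair_graph G" "card (pverts G) = Suc (Suc i)" "u \<in> pverts G" "v \<in> pverts G"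
    and "colouring G i u = colouring G i v" "colouring G (Suc i) u \<noteq> colouring G (Suc i) v"
  shows "long_refinement (Suc (Suc i)) G"
proof -
  have "WL1 G < Suc (Suc i)"
    using WL1_less_card[OF assms(1)] assms(2,3) by fastforce
  moreover have "i < WL1 G"
    using assms by (intro WL1_greater)
  ultimately show ?thesis
    using assms(1,2) by (simp add: long_refinement_def)
qed

text \<open>
  A guess \<open>col\<close> for the colours of all rounds is correct (up to renaming colours in each round) as soon
  as it satisfies the recursion of Colour Refinement up to renaming.
\<close>

lemma colouring_eq_iff_certificate:
  assumes "pair_graph G"
    and base: "\<And>u v. u \<in> pverts G \<Longrightarrow> v \<in> pverts G \<Longrightarrow> col 0 u = col 0 v"
    and step: "\<And>i u v. u \<in> pverts G \<Longrightarrow> v \<in> pverts G \<Longrightarrow> col (Suc i) u = col (Suc i) v \<longleftrightarrow>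
      col i u = col i v \<and> image_mset (col i) (mset_set (neighbourhood G u)) =
        image_mset (col i) (mset_set (neighbourhood G v))"
    and "u \<in> pverts G" "v \<in> pverts G"
  shows "colouring G i u = colouring G i v \<longleftrightarrow> col i u = col i v"
  using assms(4,5)
proof (induction i arbitrary: u v)
  case 0
  show ?case
    using base[OF 0] by simp
next
  case (Suc i)
  have "image_mset (colouring G i) (mset_set (neighbourhood G u)) =
          image_mset (colouring G i) (mset_set (neighbourhood G v)) \<longleftrightarrow>
        image_mset (col i) (mset_set (neighbourhood G u)) =
          image_mset (col i) (mset_set (neighbourhood G v))"
    using set_mset_neighbourhood[OF assms(1)] Suc.IH
    by (intro image_mset_eq_iff_kernel[where V = "pverts G"]) blast+
  then show ?case
    using step[OF Suc.prems, of i] Suc.IH[OF Suc.prems] by simp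
qed

section \<open>Invariance under renaming of vertices\<close>

definition map_graph :: "('a \<Rightarrow> 'b) \<Rightarrow> 'a pair_pre_digraph \<Rightarrow> 'b pair_pre_digraph" where
  "map_graph f G = \<lparr>pverts = f ` pverts G, parcs = {(f u, f v) | u v. (u, v) \<in> parcs G}\<rparr>"

lemma neighbourhood_map_graph:
  assumes "pair_graph G" "inj_on f (pverts G)" "v \<in> pverts G"
  shows "neighbourhood (map_graph f G) (f v) = f ` neighbourhood G v"
proof -
  have "x = v" if "f x = f v" "(x, y) \<in> parcs G" for x y
    using that assms by (auto simp: pair_graph_iff dest: inj_onD)
  then show ?thesis
    by (auto simp: neighbourhood_def map_graph_def)
qed

lemma pair_graph_map_graph:
  assumes "pair_graph G" "inj_on f (pverts G)"
  shows "pair_graph (map_graph f G)"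
proof -
  have "f x \<noteq> f y" if "(x, y) \<in> parcs G" for x y
    using that assms by (auto simp: pair_graph_iff irrefl_def dest: inj_onD)
  then show ?thesis
    using assms(1) unfolding pair_graph_iff
    by (auto simp: map_graph_def sym_def irrefl_def) blast
qed

text \<open>Colours never mention vertices, so they are literally equal, even across vertex
  types.\<close>

lemma colouring_map_graph:
  assumes "pair_graph G" "inj_on f (pverts G)" "v \<in> pverts G"
  shows "colouring (map_graph f G) i (f v) = colouring G i v"
  using assms(3)
proof (induction i arbitrary: v)
  case (Suc i)
  have sub: "neighbourhood G v \<subseteq> pverts G"
    by (rule neighbourhood_subset[OF assms(1)])
  then have "mset_set (f ` neighbourhood G v) = image_mset f (mset_set (neighbourhood G v))"
    using assms(2) by (metis image_mset_mset_set inj_on_subset)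
  then show ?case
    using Suc sub finite_neighbourhood[OF assms(1)]
    by (auto simp: neighbourhood_map_graph[OF assms(1,2)] image_mset.compositionality
        intro!: image_mset_cong)
qed simp

lemma long_refinement_map_graph:
  assumes "long_refinement n G" "inj_on f (pverts G)"
  shows "long_refinement n (map_graph f G)"
proof -
  have G: "pair_graph G"
    using assms(1) by (simp add: long_refinement_def)
  have "colour_partition (map_graph f G) j = colour_partition (map_graph f G) (Suc j) \<longleftrightarrow>
      colour_partition G j = colour_partition G (Suc j)" for j
    unfolding colour_partition_eq_iff[OF refl refl]
    using colouring_map_graph[OF G assms(2)] by (simp add: map_graph_def del: colouring.simps)
  then have "WL1 (map_graph f G) = WL1 G"
    by (simp add: WL1_def)
  then show ?thesis
    using assms pair_graph_map_graph[OF G assms(2)]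
    by (simp add: long_refinement_def map_graph_def card_image)
qed

text \<open>\<open>WL1_max\<close> ranges over graphs on natural numbers, whereas the family below
  lives on a datatype.\<close>

lemma long_refinement_nat:
  assumes "long_refinement n G"
  shows "\<exists>G' :: nat pair_pre_digraph. long_refinement n G'"
proof -
  have "finite (pverts G)"
    using assms finite_pverts by (auto simp: long_refinement_def)
  then obtain f :: "_ \<Rightarrow> nat" where "inj_on f (pverts G)"
    by (meson finite_imp_inj_to_nat_seg)
  then show ?thesis
    using long_refinement_map_graph[OF assms] by blast
qed

lemma WL1_max_eqI:
  assumes "long_refinement n G" "n > 0"
  shows "WL1_max n = n - 1"
proof -
  obtain G' :: "nat pair_pre_digraph" where G': "long_refinement n G'"
    using long_refinement_nat[OF assms(1)] by blast
  let ?W = "{WL1 G | G :: nat pair_pre_digraph. pair_graph G \<and> card (pverts G) = n}"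
  have "x \<le> n - 1" if "x \<in> ?W" for x
    using that assms(2) WL1_less_card by fastforce
  moreover from this have "finite ?W"
    by (meson finite_nat_set_iff_bounded_le)
  moreover have "n - 1 \<in> ?W"
    using G' by (auto simp: long_refinement_def intro!: exI[of _ G'])
  ultimately show ?thesis
    unfolding WL1_max_def by (intro Max_eqI) auto
qed

lemma long_refinementD:
  assumes "long_refinement (Suc (Suc i)) G"
  shows "\<exists>u \<in> pverts G. \<exists>v \<in> pverts G. colouring G i u = colouring G i v \<and> colouring G (Suc i) u \<noteq> colouring G (Suc i) v"
proof -
  have "i < (LEAST j. colour_partition G j = colour_partition G (Suc j))"
    using assms by (simp add: long_refinement_def WL1_def)
  then have "colour_partition G i \<noteq> colour_partition G (Suc i)"
    by (rule not_less_Least)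
  then show ?thesis
    unfolding colour_partition_eq_iff[OF refl refl] by (meson colouring_SucD[of G i])
qed

section \<open>Delaying the refinement by one new vertex\<close>

definition add_vertex :: "'a \<Rightarrow> 'a set \<Rightarrow> 'a pair_pre_digraph \<Rightarrow> 'a pair_pre_digraph" where
  "add_vertex w S G = \<lparr>pverts = insert w (pverts G), parcs = parcs G \<union> {w} \<times> S \<union> S \<times> {w}\<rparr>"

text \<open>
  The degrees in the new graph are all equal except that of the new vertex, so the first round only
  singles out the new vertex, and the second one has the effect of the first round on the old graph.
\<close>

lemma long_refinement_add_vertex:
  fixes G :: "'a pair_pre_digraph"
  assumes G: "long_refinement (Suc (Suc n)) G" and w: "w \<notin> pverts G"
    and S: "S = {v \<in> pverts G. card (neighbourhood G v) = d}"
    and degrees: "\<And>v. v \<in> pverts G \<Longrightarrow> card (neighbourhood G v) \<in> {d, Suc d}"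
    and card_S: "card S \<noteq> Suc d"
  shows "long_refinement (Suc (Suc (Suc n))) (add_vertex w S G)"
proof -
  let ?H = "add_vertex w S G"
  \<comment> \<open>The colouring of \<open>G\<close> delayed by one round. \<open>None\<close> is
    the class of the new vertex, and in round 0 the only colour.\<close>
  define col where "col i v = (case i of 0 \<Rightarrow> None | Suc j \<Rightarrow> if v = w then None else Some (colouring G j v))" for i v
  note G' = G[unfolded long_refinement_def, THEN conjunct1]
  have fin: "finite (neighbourhood G v)" for v
    by (rule finite_neighbourhood[OF G'])
  have S_sub: "S \<subseteq> pverts G" "finite S" "w \<notin> S"
    using S w finite_pverts[OF G'] by auto
  have H: "pair_graph ?H"
    using G' S_sub w unfolding pair_graph_iff add_vertex_def
    by (auto simp: sym_def irrefl_def)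
  have N_w: "neighbourhood ?H w = S"
    using neighbourhood_subset[OF G', of w] G' S_sub w
    by (auto simp: neighbourhood_def add_vertex_def pair_graph_iff)
  have w_nbr: "w \<notin> neighbourhood G v" for v
    using neighbourhood_subset[OF G', of v] w by auto
  have N: "neighbourhood ?H v = (if v \<in> S then insert w (neighbourhood G v) else neighbourhood G v)"
    if "v \<in> pverts G" for v
    using that w by (auto simp: neighbourhood_def add_vertex_def)
  have mset_N: "image_mset (col i) (mset_set (neighbourhood ?H v)) =
      (if v \<in> S then {#None#} else {#}) + image_mset (col i) (mset_set (neighbourhood G v))"
    if "v \<in> pverts G" for v i
    using fin w_nbr by (auto simp: N[OF that] col_def split: nat.split)
  have col_Suc: "image_mset (col (Suc i)) (mset_set (neighbourhood G v)) =
      image_mset Some (image_mset (colouring G i) (mset_set (neighbourhood G v)))" for i v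
    using fin[of v] w_nbr[of v]
    by (auto simp: image_mset.compositionality col_def intro!: image_mset_cong)
  have deg: "card (neighbourhood ?H v) = Suc d" if "v \<in> pverts G" for v
  proof -
    have "v \<in> S \<longleftrightarrow> card (neighbourhood G v) = d"
      using S that by simp
    then show ?thesis
      using degrees[OF that] fin w_nbr by (auto simp: N[OF that])
  qed
  have deg_w: "card (neighbourhood ?H w) \<noteq> Suc d"
    using card_S by (simp add: N_w)
  have step: "col (Suc i) u = col (Suc i) v \<longleftrightarrow> col i u = col i v \<and>
      image_mset (col i) (mset_set (neighbourhood ?H u)) = image_mset (col i) (mset_set (neighbourhood ?H v))"
    if "u \<in> pverts ?H" "v \<in> pverts ?H" for i u v
  proof (cases i)
    case 0
    have "image_mset (col 0) M = image_mset (col 0) M' \<longleftrightarrow> size M = size M'" for M M'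
    proof -
      have "col 0 = (\<lambda>_. None)"
        by (simp add: col_def fun_eq_iff)
      then show ?thesis
        by (auto simp: image_mset_const_eq replicate_mset_eq_iff)
    qed
    then show ?thesis
      using that deg deg_w 0 by (auto simp: col_def add_vertex_def)
  next
    case (Suc j)
    show ?thesis
    proof (cases "u = w \<or> v = w")
      case True
      then show ?thesis
        using that Suc by (auto simp: col_def)
    next
      case False
      then have uv: "u \<in> pverts G" "v \<in> pverts G"
        using that by (auto simp: add_vertex_def)
      \<comment> \<open>Membership in \<open>S\<close> shows on both sides of the equivalence: in
        the new graph by \<open>None\<close> among the neighbours' colours, in \<open>G\<close> by
        the degree.\<close>
      have inS: "x \<in> S \<longleftrightarrow> None \<in># image_mset (col i) (mset_set (neighbourhood ?H x))" if "x \<in> pverts G" for x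
        unfolding mset_N[OF that] Suc col_Suc by auto
      have "u \<in> S \<longleftrightarrow> v \<in> S" if "image_mset (colouring G j) (mset_set (neighbourhood G u)) =
          image_mset (colouring G j) (mset_set (neighbourhood G v))"
      proof -
        from that have "card (neighbourhood G u) = card (neighbourhood G v)"
          by (metis size_image_mset size_mset_set)
        then show ?thesis
          using uv S by auto
      qed
      moreover have "u \<in> S \<longleftrightarrow> v \<in> S" if "image_mset (col i) (mset_set (neighbourhood ?H u)) =
          image_mset (col i) (mset_set (neighbourhood ?H v))"
        unfolding inS[OF uv(1)] inS[OF uv(2)] that ..
      moreover have "image_mset Some M = image_mset Some M' \<longleftrightarrow> M = M'" for M M' :: "colour multiset"
        using multiset.inj_map[of Some] by (auto simp: inj_def)
      ultimately show ?thesis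
        using False unfolding mset_N[OF uv(1)] mset_N[OF uv(2)] unfolding Suc col_Suc
        by (auto simp: col_def)
    qed
  qed
  have eq_iff: "colouring ?H i u = colouring ?H i v \<longleftrightarrow> col i u = col i v"
    if "u \<in> pverts ?H" "v \<in> pverts ?H" for i u v
    by (rule colouring_eq_iff_certificate[where col = col, OF H _ step that]) (simp_all add: col_def)
  obtain u v where uv: "u \<in> pverts G" "v \<in> pverts G"
    "colouring G n u = colouring G n v" "colouring G (Suc n) u \<noteq> colouring G (Suc n) v"
    using long_refinementD[OF G] by blast
  have "u \<noteq> w" "v \<noteq> w" "u \<in> pverts ?H" "v \<in> pverts ?H"
    using uv w by (auto simp: add_vertex_def)
  moreover have "card (pverts ?H) = Suc (Suc (Suc n))"
    using G w finite_pverts[OF G'] by (simp add: add_vertex_def long_refinement_def)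
  ultimately show ?thesis
    using uv H by (intro long_refinementI[where u = u and v = v]) (simp_all add: eq_iff col_def del: colouring.simps)
qed

section \<open>A family of graphs with three arms\<close>

text \<open>
  \<open>A j b\<close>, for \<open>b\<close> a Boolean, are the two vertices of the pair of level \<open>j\<close> on the arm \<open>A\<close>. The pairs
  occur along a path in the order
  \<open>A L, \<dots>, A 0, B lo, \<dots>, B hi, C (L + 1), \<dots>, C 0\<close>.
  For \<open>lo = 1\<close>, level \<open>0\<close> of \<open>C\<close> is the single vertex \<open>C 0 False\<close>, and the vertices of level \<open>0\<close>
  form a triangle. The case \<open>hi = L\<close> inserts the pair \<open>C (L + 1)\<close> between the tops \<open>B L\<close> and \<open>C L\<close>.
  The neighbours are listed in such an order that vertices of equal colour have equal lists of
  colours.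
\<close>

datatype vertex = A nat bool | B nat bool | C nat bool

primrec is_vertex :: "nat \<Rightarrow> nat \<Rightarrow> nat \<Rightarrow> vertex \<Rightarrow> bool" where
  "is_vertex L lo hi (A j b) \<longleftrightarrow> j \<le> L"
| "is_vertex L lo hi (B j b) \<longleftrightarrow> lo \<le> j \<and> j \<le> hi"
| "is_vertex L lo hi (C j b) \<longleftrightarrow> j \<le> Suc L \<and> (lo = 1 \<and> j = 0 \<longrightarrow> \<not> b)"

primrec nbrs :: "nat \<Rightarrow> nat \<Rightarrow> nat \<Rightarrow> vertex \<Rightarrow> vertex list" where
  "nbrs L lo hi (A j b) =
    (if j = 0 then
       if lo = 0 then [A 1 b, B 0 b] else [A 1 b, B 1 b, A 0 (\<not> b), C 0 False]
     else if j < L then [A (j - 1) b, A (j + 1) b, A j (\<not> b)]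
     else if b then [A (j - 1) b, C hi False, C hi True]
     else [A (j - 1) b, B hi False, B hi True])"
| "nbrs L lo hi (B j b) =
    (if j = 0 then [B 1 b, A 0 b]
     else [if j = lo then A 0 b else B (j - 1) b,
           if j = hi then C (Suc L) b else B (j + 1) b,
           if j = hi then A L False else B j (\<not> b)])"
| "nbrs L lo hi (C j b) =
    (if j = 0 then
       if lo = 0 then [C 1 b, C 0 (\<not> b)] else [C 1 False, C 1 True, A 0 False, A 0 True]
     else [C (j - 1) (b \<and> (j = 1 \<longrightarrow> lo = 0)),
           if j = Suc L then B hi b else C (j + 1) b,
           if j = hi then A L True else C j (\<not> b)])"

definition family_graph :: "nat \<Rightarrow> nat \<Rightarrow> nat \<Rightarrow> vertex pair_pre_digraph" where
  "family_graph L lo hi = \<lparr>pverts = {v. is_vertex L lo hi v}, parcs = {(u, v). is_vertex L lo hi u \<and> v \<in> set (nbrs L lo hi u)}\<rparr>"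

primrec level :: "vertex \<Rightarrow> nat" where
  "level (A j b) = j" | "level (B j b) = j" | "level (C j b) = j"

text \<open>
  The predicates \<open>split_A L i\<close>, \<open>split_B L lo i\<close> and \<open>split_pair L lo hi i\<close> say that round \<open>i\<close> has
  separated a vertex of \<open>A\<close> from its level on the other arms, a vertex of \<open>B\<close> from its level on \<open>C\<close>,
  and the \<open>True\<close>-vertex of a pair from the other one, respectively.
\<close>

primrec split_A :: "nat \<Rightarrow> nat \<Rightarrow> vertex \<Rightarrow> bool" where
  "split_A L i (A j b) \<longleftrightarrow> 2 * L + 2 \<le> i + j" | "split_A L i (B j b) \<longleftrightarrow> False" | "split_A L i (C j b) \<longleftrightarrow> False"

primrec split_B :: "nat \<Rightarrow> nat \<Rightarrow> nat \<Rightarrow> vertex \<Rightarrow> bool" where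
  "split_B L lo i (A j b) \<longleftrightarrow> False"
| "split_B L lo i (B j b) \<longleftrightarrow> 2 * L + 3 + j \<le> i + lo"
| "split_B L lo i (C j b) \<longleftrightarrow> False"

primrec split_pair :: "nat \<Rightarrow> nat \<Rightarrow> nat \<Rightarrow> nat \<Rightarrow> vertex \<Rightarrow> bool" where
  "split_pair L lo hi i (A j b) \<longleftrightarrow> b \<and> 3 * L + 4 + hi \<le> i + j + lo"
| "split_pair L lo hi i (B j b) \<longleftrightarrow> b \<and> 3 * L + 5 + hi + j \<le> i + 2 * lo"
| "split_pair L lo hi i (C j b) \<longleftrightarrow> b \<and> 4 * L + 7 + 2 * hi \<le> i + j + 2 * lo"

text \<open>The first component says that round \<open>i\<close> has recognised the levels below
  \<open>i\<close>, while those from \<open>i\<close> on are not yet told apart.\<close>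

definition family_col :: "nat \<Rightarrow> nat \<Rightarrow> nat \<Rightarrow> nat \<Rightarrow> vertex \<Rightarrow> nat \<times> bool \<times> bool \<times> bool" where
  "family_col L lo hi i v = (min (level v) i, split_A L i v, split_B L lo i v, split_pair L lo hi i v)"

locale refinement_family =
  fixes L lo hi :: nat
  assumes L_pos: "0 < L" and lo_cases: "lo = 0 \<or> lo = 1" and hi_cases: "hi = L \<or> hi = Suc L"
begin

abbreviation "arm_graph \<equiv> family_graph L lo hi"
abbreviation "vert \<equiv> is_vertex L lo hi"
abbreviation "nb \<equiv> nbrs L lo hi"
abbreviation "col \<equiv> family_col L lo hi"

section \<open>Adjacency and order of the three-arm graphs\<close>

lemma nbrs_sym:
  assumes "vert u" "v \<in> set (nb u)"
  shows "vert v" "u \<in> set (nb v)"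
  using assms L_pos lo_cases hi_cases
  by (cases u; auto split: if_splits)+

lemma distinct_nbrs: "vert u \<Longrightarrow> distinct (nb u)"
  using L_pos lo_cases hi_cases by (cases u) (auto split: if_splits)

lemma nbrs_irrefl: "u \<notin> set (nb u)"
  using L_pos lo_cases hi_cases by (cases u) (auto split: if_splits)

lemma vertices_eq:
  "{v. vert v} = (\<lambda>(j, b). A j b) ` ({..L} \<times> UNIV) \<union> (\<lambda>(j, b). B j b) ` ({lo..hi} \<times> UNIV) \<union>
     (\<lambda>(j, b). C j b) ` ({..Suc L} \<times> UNIV - (if lo = 1 then {(0, True)} else {}))"
proof (intro set_eqI)
  fix v
  show "v \<in> {v. vert v} \<longleftrightarrow> v \<in> (\<lambda>(j, b). A j b) ` ({..L} \<times> UNIV) \<union> (\<lambda>(j, b). B j b) ` ({lo..hi} \<times> UNIV) \<union>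
     (\<lambda>(j, b). C j b) ` ({..Suc L} \<times> UNIV - (if lo = 1 then {(0, True)} else {}))"
    by (cases v) (auto simp: image_iff Bex_def)
qed

lemma finite_vertices: "finite {v. vert v}"
  by (simp add: vertices_eq)

text \<open>Taking \<open>lo = 1\<close> costs three vertices: the pair \<open>B 0\<close> and
  \<open>C 0 True\<close>. The additive form avoids truncated subtraction.\<close>

lemma card_vertices: "card {v. vert v} + 3 * lo = 4 * L + 8 + 2 * hi"
proof -
  have "card ((\<lambda>(j, b). A j b) ` ({..L} \<times> UNIV)) = 2 * L + 2"
    by (subst card_image) (auto simp: inj_on_def card_cartesian_product)
  moreover have "card ((\<lambda>(j, b). B j b) ` ({lo..hi} \<times> UNIV)) + 2 * lo = 2 * hi + 2"
    using lo_cases hi_cases L_pos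
    by (subst card_image) (auto simp: inj_on_def card_cartesian_product)
  moreover have "card ((\<lambda>(j, b). C j b) ` ({..Suc L} \<times> UNIV - (if lo = 1 then {(0, True)} else {}))) + lo = 2 * L + 4"
    using lo_cases
    by (subst card_image) (auto simp: inj_on_def card_cartesian_product card_Diff_subset)
  ultimately show ?thesis
    unfolding vertices_eq
    by (subst card_Un_disjoint; (subst card_Un_disjoint)?) auto
qed

lemma pair_graph_family_graph: "pair_graph arm_graph"
  unfolding pair_graph_iff family_graph_def sym_def irrefl_def
  using nbrs_sym nbrs_irrefl finite_vertices by (auto simp del: nbrs.simps)

lemma neighbourhood_family_graph: "vert v \<Longrightarrow> neighbourhood arm_graph v = set (nb v)"
  by (simp add: neighbourhood_def family_graph_def)

section \<open>Vertices that stay together\<close>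

text \<open>The irregular joins at the top are invisible because all levels from \<open>L\<close> on
  are capped to \<open>i\<close>.\<close>

lemma level_nbrs:
  assumes "vert v" "i \<le> L"
  shows "map (\<lambda>x. min (level x) i) (nb v) =
    (if level v = 0 then if lo = 0 then [min 1 i, 0] else [min 1 i, min 1 i, 0, 0]
     else [min (level v - 1) i, min (level v + 1) i, min (level v) i])"
  using assms L_pos lo_cases hi_cases
  by (cases v; auto)

text \<open>The first split is that of the top of \<open>A\<close>, in round
  \<open>L + 2\<close>.\<close>

lemma family_col_early:
  assumes "vert v" "i \<le> Suc L"
  shows "col i v = (min (level v) i, False, False, False)"
  using assms L_pos lo_cases hi_cases
  by (cases v; auto simp: family_col_def)

lemma family_col_late:
  assumes "vert v" "Suc L \<le> i"
  shows "col i v = (level v, split_A L i v, split_B L lo i v, split_pair L lo hi i v)"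
  using assms hi_cases
  by (cases v; auto simp: family_col_def)

lemma family_col_nbrs_early:
  assumes "vert u" "vert v" "col (Suc i) u = col (Suc i) v" "i \<le> L"
  shows "map (col i) (nb u) = map (col i) (nb v)"
proof -
  have col: "map (col i) (nb v) = map (\<lambda>k. (k, False, False, False)) (map (\<lambda>x. min (level x) i) (nb v))"
    if "vert v" for v
    using that nbrs_sym(1) \<open>i \<le> L\<close> unfolding map_map
    by (intro map_cong) (auto simp: family_col_early)
  have "min (level u) (Suc i) = min (level v) (Suc i)"
    using assms by (simp add: family_col_def)
  then have "level u = level v \<or> level u > i \<and> level v > i"
    by (auto simp: min_def split: if_splits)
  then show ?thesis
    unfolding col[OF assms(1)] col[OF assms(2)] level_nbrs[OF assms(1,4)] level_nbrs[OF assms(2,4)]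
    by auto
qed

text \<open>As long as two vertices are not due to be separated, their neighbour lists agree in
  colour entry by entry. This lemma and the next five compare the two vertices of a pair, or two
  arms at equal level.\<close>

lemma family_col_nbrs_AA:
  assumes "vert (A j True)" "\<not> split_pair L lo hi (Suc i) (A j True)"
  shows "map (col i) (nb (A j True)) = map (col i) (nb (A j False))"
  using L_pos lo_cases hi_cases assms by (elim disjE) (auto simp: family_col_def)
lemma family_col_nbrs_BB:
  assumes "vert (B j True)" "\<not> split_pair L lo hi (Suc i) (B j True)"
  shows "map (col i) (nb (B j True)) = map (col i) (nb (B j False))"
  using L_pos lo_cases hi_cases assms by (elim disjE) (auto simp: family_col_def)
lemma family_col_nbrs_CC:
  assumes "vert (C j True)" "\<not> split_pair L lo hi (Suc i) (C j True)"
  shows "map (col i) (nb (C j True)) = map (col i) (nb (C j False))"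
  using L_pos lo_cases hi_cases assms by (elim disjE) (auto simp: family_col_def)
lemma family_col_nbrs_BC:
  assumes "vert (B j b)" "vert (C j c)" "\<not> split_B L lo (Suc i) (B j b)" "Suc L \<le> i"
  shows "map (col i) (nb (B j b)) = map (col i) (nb (C j c))"
  using assms L_pos lo_cases hi_cases unfolding family_col_def
  by (auto split: if_splits)
lemma family_col_nbrs_AB:
  assumes "vert (A j b)" "vert (B j c)" "\<not> split_A L (Suc i) (A j b)" "Suc L \<le> i"
  shows "map (col i) (nb (A j b)) = map (col i) (nb (B j c))"
  using assms L_pos lo_cases hi_cases unfolding family_col_def
  by (auto split: if_splits)
lemma family_col_nbrs_AC:
  assumes "vert (A j b)" "vert (C j c)" "\<not> split_A L (Suc i) (A j b)" "Suc L \<le> i"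
  shows "map (col i) (nb (A j b)) = map (col i) (nb (C j c))"
  using assms L_pos lo_cases hi_cases unfolding family_col_def
  by (auto split: if_splits)

lemma family_col_nbrs_eq:
  assumes "vert u" "vert v" "col (Suc i) u = col (Suc i) v"
  shows "map (col i) (nb u) = map (col i) (nb v)"
proof (cases "i \<le> L")
  case True
  then show ?thesis
    using family_col_nbrs_early assms by blast
next
  case False
  then have "level u = level v" "split_A L (Suc i) u = split_A L (Suc i) v"
    "split_B L lo (Suc i) u = split_B L lo (Suc i) v"
    "split_pair L lo hi (Suc i) u = split_pair L lo hi (Suc i) v"
    using assms by (simp_all add: family_col_late)
  with assms(1,2) False show ?thesis
    apply (cases u; cases v)
    subgoal for j b j' b' by (cases b; cases b') (auto simp del: nbrs.simps intro: family_col_nbrs_AA family_col_nbrs_AA[symmetric])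
    subgoal by (auto simp del: nbrs.simps intro!: family_col_nbrs_AB)
    subgoal by (auto simp del: nbrs.simps intro!: family_col_nbrs_AC)
    subgoal by (auto simp del: nbrs.simps intro!: family_col_nbrs_AB[symmetric])
    subgoal for j b j' b' by (cases b; cases b') (auto simp del: nbrs.simps intro: family_col_nbrs_BB family_col_nbrs_BB[symmetric])
    subgoal by (auto simp del: nbrs.simps intro!: family_col_nbrs_BC)
    subgoal by (auto simp del: nbrs.simps intro!: family_col_nbrs_AC[symmetric])
    subgoal by (auto simp del: nbrs.simps intro!: family_col_nbrs_BC[symmetric])
    subgoal for j b j' b' by (cases b; cases b') (auto simp del: nbrs.simps intro: family_col_nbrs_CC family_col_nbrs_CC[symmetric])
    done
qed

section \<open>Vertices that are separated\<close>

text \<open>For \<open>i = 0\<close> the degrees differ; for \<open>i > 0\<close> only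
  \<open>u\<close> has a neighbour of level \<open>i - 1\<close>.\<close>

lemma level_split:
  assumes "vert u" "vert v" "level u = i" "i < level v"
  shows "image_mset (col i) (mset (nb u)) \<noteq> image_mset (col i) (mset (nb v))"
proof
  assume "image_mset (col i) (mset (nb u)) = image_mset (col i) (mset (nb v))"
  then have "image_mset fst (image_mset (col i) (mset (nb u))) = image_mset fst (image_mset (col i) (mset (nb v)))"
    by simp
  then have "mset (map (\<lambda>x. min (level x) i) (nb u)) = mset (map (\<lambda>x. min (level x) i) (nb v))"
    by (simp add: family_col_def image_mset.compositionality comp_def)
  moreover have "i \<le> L"
    using assms hi_cases by (cases v) auto
  ultimately show False
    using assms(3,4) by (simp add: level_nbrs[OF assms(1)] level_nbrs[OF assms(2)] split: if_splits)
qed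

text \<open>\<open>A (Suc j) b\<close> split off in round \<open>i\<close>, and a vertex of level
  \<open>j\<close> off \<open>A\<close> has no neighbour of level \<open>Suc j\<close> on
  \<open>A\<close>.\<close>

lemma A_split_below:
  assumes "vert (A j b)" "vert v" "level v = j" "\<And>b. v \<noteq> A j b" "Suc i + j = 2 * L + 2" "j < L"
  shows "col i (A (Suc j) b) \<notin> col i ` set (nb v)"
  using assms L_pos lo_cases hi_cases
  by (cases v; auto simp: family_col_def)

text \<open>The witness depends on \<open>hi\<close>: \<open>A L b\<close> sees no vertex of level
  \<open>L + 1\<close> if \<open>hi = L\<close>, and none of level \<open>L\<close> if
  \<open>hi = L + 1\<close>, whereas the level-\<open>L\<close> vertices of the other arms
  do.\<close>

lemma A_split_top:
  assumes "vert v" "level v = L" "\<And>b. v \<noteq> A L b"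
  shows "\<exists>x \<in> set (nb v). col (Suc L) x \<notin> col (Suc L) ` set (nb (A L b))"
proof (cases v)
  case (A j b')
  then show ?thesis using assms(2) assms(3)[of b'] by simp
next
  case (B j c)
  then show ?thesis using assms L_pos hi_cases
    by (elim disjE) (auto simp: family_col_def)
next
  case (C j c)
  then show ?thesis using assms L_pos hi_cases
    by (elim disjE) (auto simp: family_col_def)
qed

text \<open>The witness is the preceding vertex on the path, which split off in round
  \<open>i\<close>.\<close>

lemma B_split:
  assumes "vert (B j b)" "vert (C j c)" "Suc i + lo = 2 * L + 3 + j"
  shows "col i (if j = lo then A 0 b else B (j - 1) b) \<notin> col i ` set (nb (C j c))"
  using assms L_pos lo_cases hi_cases
  by (elim disjE; auto simp: family_col_def)

text \<open>\<open>B hi\<close> has just been told from \<open>C hi\<close>;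
  \<open>A L False\<close> sees the former, \<open>A L True\<close> the latter.\<close>

lemma pair_split_top:
  assumes "Suc i + lo = 2 * L + 4 + hi"
  shows "col i (B hi True) \<notin> col i ` set (nb (A L True))"
  using assms L_pos lo_cases hi_cases
  by (elim disjE; auto simp: family_col_def)

text \<open>Here and in the next two lemmas, the preceding \<open>True\<close>-vertex on the path
  has just been told from its partner, and the matching passes this on.\<close>

lemma pair_split_A:
  assumes "Suc i + j + lo = 3 * L + 4 + hi" "j < L"
  shows "col i (A (Suc j) True) \<notin> col i ` set (nb (A j False))"
  using assms L_pos lo_cases hi_cases
  by (elim disjE; auto simp: family_col_def)

lemma pair_split_B:
  assumes "Suc i + 2 * lo = 3 * L + 5 + hi + j" "vert (B j True)"
  shows "col i (if j = lo then A 0 True else B (j - 1) True) \<notin> col i ` set (nb (B j False))"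
  using assms L_pos lo_cases hi_cases
  by (elim disjE; auto simp: family_col_def)

lemma pair_split_C:
  assumes "Suc i + j + 2 * lo = 4 * L + 7 + 2 * hi" "vert (C j True)"
  shows "col i (if j = Suc L then B hi True else C (Suc j) True) \<notin> col i ` set (nb (C j False))"
  using assms L_pos lo_cases hi_cases
  by (elim disjE; auto simp: family_col_def)

lemma split_A_differ:
  assumes "vert u" "vert v" "col i u = col i v"
    and "split_A L (Suc i) u" "\<not> split_A L (Suc i) v"
  shows "col i ` set (nb u) \<noteq> col i ` set (nb v)"
proof -
  obtain j b where u: "u = A j b"
    using assms(4) by (cases u) auto
  \<comment> \<open>The predicates are monotone in the round, so \<open>v\<close> is not split in
    round \<open>i\<close>; equal colours pass this on to \<open>u\<close>, which fixes
    \<open>i\<close> at the threshold.\<close>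
  have "\<not> split_A L i u"
    using assms(3,5) by (cases v) (auto simp: family_col_def)
  then have i: "Suc i + j = 2 * L + 2"
    using assms(4) u by simp
  then have late: "Suc L \<le> i"
    using assms(1) u by simp
  then have "level v = j"
    using assms(1-3) u by (simp add: family_col_late)
  moreover have "v \<noteq> A j c" for c
    using assms(5) i by auto
  moreover have "A (Suc j) b \<in> set (nb u)" if "j < L"
    using u that by simp
  moreover have "i = Suc L" if "j = L"
    using i that by simp
  ultimately show ?thesis
    using A_split_below[of j b v i] A_split_top[of v b] i assms(1,2) u
    by (cases "j < L") (fastforce simp del: nbrs.simps)+
qed

lemma split_B_differ:
  assumes "vert u" "vert v" "col i u = col i v"
    and "split_B L lo (Suc i) u" "\<not> split_B L lo (Suc i) v"
  shows "col i ` set (nb u) \<noteq> col i ` set (nb v)"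
proof -
  obtain j b where u: "u = B j b"
    using assms(4) by (cases u) auto
  have "\<not> split_B L lo i u"
    using assms(3,5) by (cases v) (auto simp: family_col_def)
  then have i: "Suc i + lo = 2 * L + 3 + j"
    using assms(4) u by simp
  then have late: "Suc L \<le> i"
    using lo_cases by auto
  then have v: "level v = j" "\<not> split_A L i v"
    using assms(1-3) u by (simp_all add: family_col_late)
  obtain c where c: "v = C j c"
    using v i assms(1,5) u lo_cases by (cases v) auto
  define x where "x = (if j = lo then A 0 b else B (j - 1) b)"
  have "x \<in> set (nb u)"
    using u assms(1) by (auto simp: x_def)
  moreover have "col i x \<notin> col i ` set (nb v)"
    unfolding x_def c using assms(1,2) u c i by (intro B_split) simp_all
  ultimately show ?thesis
    by blast
qed

lemma split_pair_differ:
  assumes "vert u" "vert v" "col i u = col i v"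
    and "split_pair L lo hi (Suc i) u" "\<not> split_pair L lo hi (Suc i) v"
  shows "col i ` set (nb u) \<noteq> col i ` set (nb v)"
proof -
  have not_u: "\<not> split_pair L lo hi i u"
    using assms(3,5) by (cases v) (auto simp: family_col_def)
  then have late: "Suc L \<le> i"
    using assms(1,4) lo_cases hi_cases by (cases u) auto
  then have v: "level v = level u" "split_A L i v = split_A L i u" "split_B L lo i v = split_B L lo i u"
    using assms(1-3) by (simp_all add: family_col_late)
  show ?thesis
  proof (cases u)
    case (A j b)
    with assms(4) not_u have i: "b" "Suc i + j + lo = 3 * L + 4 + hi"
      by auto
    have "v = A j False"
      using v i A assms(1,5) lo_cases hi_cases by (cases v) auto
    moreover have "col i (B hi True) \<in> col i ` set (nb (A L False))"
      using L_pos by auto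
    moreover have "A (Suc j) True \<in> set (nb (A j True))" if "j < L"
      using that by simp
    ultimately show ?thesis
      using A i assms(1) pair_split_top[of i] pair_split_A[of i j]
      by (cases "j < L") (auto simp del: nbrs.simps)
  next
    case (B j b)
    with assms(4) not_u have i: "b" "Suc i + 2 * lo = 3 * L + 5 + hi + j"
      by auto
    have v_eq: "v = B j False"
      using v i B assms(1,5) lo_cases hi_cases by (cases v) auto
    define x where "x = (if j = lo then A 0 True else B (j - 1) True)"
    have "x \<in> set (nb u)"
      using assms(1) B i by (auto simp: x_def)
    moreover have "col i x \<notin> col i ` set (nb v)"
      unfolding x_def v_eq using assms(1) B i by (intro pair_split_B) simp_all
    ultimately show ?thesis
      by blast
  next
    case (C j b)
    with assms(4) not_u have i: "b" "Suc i + j + 2 * lo = 4 * L + 7 + 2 * hi"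
      by auto
    have v_eq: "v = C j False"
      using v i C assms(1,2,5) lo_cases hi_cases by (cases v) auto
    define x where "x = (if j = Suc L then B hi True else C (Suc j) True)"
    have "x \<in> set (nb u)"
      using assms(1) C i lo_cases by (auto simp: x_def)
    moreover have "col i x \<notin> col i ` set (nb v)"
      unfolding x_def v_eq using assms(1) C i by (intro pair_split_C) simp_all
    ultimately show ?thesis
      by blast
  qed
qed

text \<open>Forwards, the guess misses no split, as neighbour lists agree. Backwards, every
  predicted split has a witness among the neighbours.\<close>

lemma family_col_Suc_eq_iff:
  assumes "vert u" "vert v"
  shows "col (Suc i) u = col (Suc i) v \<longleftrightarrow> col i u = col i v \<and>
    image_mset (col i) (mset (nb u)) = image_mset (col i) (mset (nb v))"
proof (intro iffI conjI)
  assume eq: "col (Suc i) u = col (Suc i) v"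
  show "image_mset (col i) (mset (nb u)) = image_mset (col i) (mset (nb v))"
    using family_col_nbrs_eq[OF assms eq] by (metis mset_map)
  show "col i u = col i v"
  proof (cases "i \<le> L")
    case True
    then show ?thesis
      using eq assms by (auto simp: family_col_early min_def split: if_splits)
  next
    case False
    then show ?thesis
      using eq assms lo_cases hi_cases by (cases u; cases v; simp add: family_col_late; linarith)
  qed
next
  assume "col i u = col i v \<and>
    image_mset (col i) (mset (nb u)) = image_mset (col i) (mset (nb v))"
  then have eq: "col i u = col i v"
    and msets: "image_mset (col i) (mset (nb u)) = image_mset (col i) (mset (nb v))"
    by simp_all
  \<comment> \<open>Sets of colours detect the splits of arms and pairs. Multiplicities matter for
    the levels: the first round compares degrees.\<close>
  from msets have sets: "col i ` set (nb u) = col i ` set (nb v)"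
    by (metis set_image_mset set_mset_mset)
  have "min (level u) (Suc i) = min (level v) (Suc i)"
  proof (rule ccontr)
    assume "\<not> ?thesis"
    moreover have "min (level u) i = min (level v) i"
      using eq by (simp add: family_col_def)
    ultimately have "level u = i \<and> i < level v \<or> level v = i \<and> i < level u"
      by linarith
    then show False
      using level_split assms msets by metis
  qed
  moreover have "split_A L (Suc i) u = split_A L (Suc i) v"
    using split_A_differ[OF assms eq] split_A_differ[OF assms(2,1) eq[symmetric]] sets by blast
  moreover have "split_B L lo (Suc i) u = split_B L lo (Suc i) v"
    using split_B_differ[OF assms eq] split_B_differ[OF assms(2,1) eq[symmetric]] sets by blast
  moreover have "split_pair L lo hi (Suc i) u = split_pair L lo hi (Suc i) v"
    using split_pair_differ[OF assms eq] split_pair_differ[OF assms(2,1) eq[symmetric]] sets by blast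
  ultimately show "col (Suc i) u = col (Suc i) v"
    by (simp add: family_col_def)
qed

section \<open>The family and its one-vertex extensions\<close>

lemma long_refinement_family: "long_refinement (4 * L + 8 + 2 * hi - 3 * lo) arm_graph"
proof -
  define i where "i = 4 * L + 6 + 2 * hi - 3 * lo"
  have i: "i + 3 * lo = 4 * L + 6 + 2 * hi" "Suc (Suc i) = 4 * L + 8 + 2 * hi - 3 * lo"
    using L_pos lo_cases by (auto simp: i_def)
  have verts: "pverts arm_graph = {v. vert v}"
    by (simp add: family_graph_def)
  have eq_iff: "colouring arm_graph k u = colouring arm_graph k v \<longleftrightarrow>
      col k u = col k v" if "vert u" "vert v" for k u v
  proof (rule colouring_eq_iff_certificate)
    fix u v k
    assume "u \<in> pverts arm_graph" "v \<in> pverts arm_graph"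
    then have uv: "vert u" "vert v"
      by (simp_all add: verts)
    show "col 0 u = col 0 v"
      using uv by (simp add: family_col_early)
    have "mset_set (neighbourhood arm_graph x) = mset (nb x)" if "vert x" for x
      using that by (simp add: neighbourhood_family_graph distinct_nbrs mset_set_set del: nbrs.simps)
    then show "col (Suc k) u = col (Suc k) v \<longleftrightarrow> col k u = col k v \<and>
        image_mset (col k) (mset_set (neighbourhood arm_graph u)) =
        image_mset (col k) (mset_set (neighbourhood arm_graph v))"
      using uv by (simp add: family_col_Suc_eq_iff del: nbrs.simps)
  qed (use that pair_graph_family_graph in \<open>auto simp: verts\<close>)
  have C: "vert (C lo True)" "vert (C lo False)"
    using lo_cases by auto
  have late: "Suc L \<le> i"
    using i lo_cases by auto
  have "long_refinement (Suc (Suc i)) arm_graph"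
  \<comment> \<open>\<open>C lo\<close> is the last pair to split, in round \<open>Suc i\<close>;
    for \<open>lo = 1\<close>, level 0 of \<open>C\<close> is a single vertex.\<close>
  proof (rule long_refinementI[where u = "C lo True" and v = "C lo False"])
    show "card (pverts arm_graph) = Suc (Suc i)"
      using card_vertices i lo_cases by (simp add: verts)
    show "colouring arm_graph i (C lo True) = colouring arm_graph i (C lo False)"
      unfolding eq_iff[OF C] using C late i by (simp add: family_col_late)
    show "colouring arm_graph (Suc i) (C lo True) \<noteq> colouring arm_graph (Suc i) (C lo False)"
      unfolding eq_iff[OF C] using C late i by (simp add: family_col_late)
  qed (use pair_graph_family_graph C verts in auto)
  then show ?thesis
    by (simp add: i)
qed

lemma card_neighbourhood:
  assumes "vert v"
  shows "card (neighbourhood arm_graph v) = (if level v = 0 then if lo = 0 then 2 else 4 else 3)"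
proof -
  have "length (nb v) = (if level v = 0 then if lo = 0 then 2 else 4 else 3)"
    using L_pos assms by (cases v) auto
  then show ?thesis
    using assms by (simp add: neighbourhood_family_graph distinct_card distinct_nbrs del: nbrs.simps)
qed

lemma long_refinement_family_add_vertex:
  "\<exists>G :: vertex pair_pre_digraph. long_refinement (4 * L + 9 + 2 * hi - 3 * lo) G"
proof -
  let ?G = arm_graph
  \<comment> \<open>\<open>d\<close> is the smaller degree, so \<open>S\<close> is level 0 for
    \<open>lo = 0\<close> and everything above it for \<open>lo = 1\<close>.\<close>
  define d where "d = (if lo = 0 then 2 else 3 :: nat)"
  define S where "S = {v \<in> pverts ?G. card (neighbourhood ?G v) = d}"
  have verts: "pverts ?G = {v. vert v}"
    by (simp add: family_graph_def)
  have S_iff: "v \<in> S \<longleftrightarrow> vert v \<and> (level v = 0 \<longleftrightarrow> lo = 0)" for v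
    unfolding S_def d_def verts by (cases "vert v"; cases "level v = 0"; simp add: card_neighbourhood)
  have "finite S"
    using finite_vertices by (simp add: S_def verts)
  \<comment> \<open>The degree of the new vertex must differ from the common degree
    \<open>Suc d\<close> of the others; a few members of \<open>S\<close> already ensure
    this.\<close>
  have "Suc d < card S"
  proof (cases "lo = 0")
    case True
    have "{A 0 True, A 0 False, B 0 True, B 0 False} \<subseteq> S"
      using True by (simp add: S_iff)
    from card_mono[OF \<open>finite S\<close> this] show ?thesis
      using True by (simp add: d_def)
  next
    case False
    then have "{A 1 True, A 1 False, B 1 True, B 1 False, C 1 True} \<subseteq> S"
      using L_pos lo_cases hi_cases by (auto simp: S_iff)
    from card_mono[OF \<open>finite S\<close> this] show ?thesis
      using False by (simp add: d_def)
  qed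
  moreover have "card (neighbourhood ?G v) \<in> {d, Suc d}" if "v \<in> pverts ?G" for v
    using that by (simp add: verts card_neighbourhood d_def)
  moreover have "A (Suc L) True \<notin> pverts ?G"
    by (simp add: verts)
  moreover have "Suc (Suc (4 * L + 6 + 2 * hi - 3 * lo)) = 4 * L + 8 + 2 * hi - 3 * lo"
    using lo_cases by auto
  ultimately have "long_refinement (Suc (Suc (Suc (4 * L + 6 + 2 * hi - 3 * lo)))) (add_vertex (A (Suc L) True) S ?G)"
    using long_refinement_family by (intro long_refinement_add_vertex[OF _ _ S_def]) auto
  moreover have "Suc (Suc (Suc (4 * L + 6 + 2 * hi - 3 * lo))) = 4 * L + 9 + 2 * hi - 3 * lo"
    using lo_cases by auto
  ultimately show ?thesis
    by metis
qed

end

section \<open>The orders from 10 on\<close>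

definition nbrs10 :: "nat list list" where
  "nbrs10 =
    [[1, 3, 4], [0, 3, 7, 9], [6, 7, 8], [0, 1, 8], [0, 7, 9],
     [6, 8, 9], [2, 5, 9], [1, 2, 4], [2, 3, 5], [1, 4, 5, 6]]"

definition graph10 :: "nat pair_pre_digraph" where
  "graph10 = \<lparr>pverts = {..<10}, parcs = {(u, v). u < 10 \<and> v \<in> set (nbrs10 ! u)}\<rparr>"

text \<open>The entry \<open>colours10 ! i ! v\<close> is the least vertex with the colour of \<open>v\<close> in round \<open>i\<close>.\<close>

definition colours10 :: "nat list list" where
  "colours10 =
    [[0, 0, 0, 0, 0, 0, 0, 0, 0, 0], [0, 1, 0, 0, 0, 0, 0, 0, 0, 1], [0, 1, 2, 0, 0, 0, 0, 0, 2, 1], [0, 1, 2, 3, 0, 3, 3, 3, 2, 1], [0, 1, 2, 3, 0, 5, 5, 3, 2, 1],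
     [0, 1, 2, 3, 0, 5, 5, 3, 2, 9], [0, 1, 2, 3, 4, 5, 5, 3, 2, 9], [0, 1, 2, 3, 4, 5, 5, 7, 2, 9], [0, 1, 2, 3, 4, 5, 5, 7, 8, 9], [0, 1, 2, 3, 4, 5, 6, 7, 8, 9]]"

lemma nbrs10_simple:
  assumes "u < 10"
  shows "distinct (nbrs10 ! u)" "u \<notin> set (nbrs10 ! u)"
    and "v \<in> set (nbrs10 ! u) \<Longrightarrow> v < 10" "v \<in> set (nbrs10 ! u) \<Longrightarrow> u \<in> set (nbrs10 ! v)"
proof -
  have "\<forall>u \<in> set [0..<10]. distinct (nbrs10 ! u) \<and> u \<notin> set (nbrs10 ! u) \<and>
      (\<forall>v \<in> set (nbrs10 ! u). v < 10 \<and> u \<in> set (nbrs10 ! v))"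
    by code_simp
  moreover have "u \<in> set [0..<10]"
    unfolding set_upt using assms by simp
  ultimately have "distinct (nbrs10 ! u) \<and> u \<notin> set (nbrs10 ! u) \<and>
      (\<forall>v \<in> set (nbrs10 ! u). v < 10 \<and> u \<in> set (nbrs10 ! v))"
    by (rule bspec)
  then show "distinct (nbrs10 ! u)" "u \<notin> set (nbrs10 ! u)"
    "v \<in> set (nbrs10 ! u) \<Longrightarrow> v < 10" "v \<in> set (nbrs10 ! u) \<Longrightarrow> u \<in> set (nbrs10 ! v)"
    by blast+
qed

text \<open>Sorted lists stand for multisets, to make the check executable. The case
  \<open>i = 9\<close> says that the last row is stable, which covers all later rounds.\<close>

lemma colours10_step:
  assumes "i < 10" "u < 10" "v < 10"
  shows "colours10 ! min (Suc i) 9 ! u = colours10 ! min (Suc i) 9 ! v \<longleftrightarrow>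
     colours10 ! i ! u = colours10 ! i ! v \<and>
     sort (map ((!) (colours10 ! i)) (nbrs10 ! u)) = sort (map ((!) (colours10 ! i)) (nbrs10 ! v))"
proof -
  have "\<forall>i \<in> set [0..<10]. \<forall>u \<in> set [0..<10]. \<forall>v \<in> set [0..<10].
      colours10 ! min (Suc i) 9 ! u = colours10 ! min (Suc i) 9 ! v \<longleftrightarrow>
      colours10 ! i ! u = colours10 ! i ! v \<and>
      sort (map ((!) (colours10 ! i)) (nbrs10 ! u)) = sort (map ((!) (colours10 ! i)) (nbrs10 ! v))"
    by code_simp
  moreover have "i \<in> set [0..<10]" "u \<in> set [0..<10]" "v \<in> set [0..<10]"
    unfolding set_upt using assms by simp_all
  ultimately show ?thesis
    by blast
qed

lemma long_refinement_graph10: "long_refinement 10 graph10"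
proof -
  define col where "col i v = colours10 ! min i 9 ! v" for i v
  have verts: "pverts graph10 = {..<10}"
    by (simp add: graph10_def)
  have G: "pair_graph graph10"
    unfolding pair_graph_iff graph10_def by (auto simp: sym_def irrefl_def dest: nbrs10_simple(2-4))
  have mset_N: "mset_set (neighbourhood graph10 v) = mset (nbrs10 ! v)" if "v < 10" for v
  proof -
    have "neighbourhood graph10 v = set (nbrs10 ! v)"
      using that by (simp add: neighbourhood_def graph10_def)
    then show ?thesis
      using nbrs10_simple(1)[OF that] by (simp add: mset_set_set)
  qed
  have eq_iff: "colouring graph10 i u = colouring graph10 i v \<longleftrightarrow> col i u = col i v" if "u < 10" "v < 10" for i u v
  proof (rule colouring_eq_iff_certificate[OF G])
    fix i u v
    assume "u \<in> pverts graph10" "v \<in> pverts graph10"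
    then have uv: "u < 10" "v < 10"
      by (simp_all add: verts)
    have "col (Suc i) u = col (Suc i) v \<longleftrightarrow> col i u = col i v \<and>
        sort (map (col i) (nbrs10 ! u)) = sort (map (col i) (nbrs10 ! v))"
      using colours10_step[of "min i 9" u v] uv
      by (cases "i < 9") (simp_all add: col_def[abs_def])
    also have "sort (map (col i) (nbrs10 ! u)) = sort (map (col i) (nbrs10 ! v)) \<longleftrightarrow>
        mset (map (col i) (nbrs10 ! u)) = mset (map (col i) (nbrs10 ! v))"
      by (metis mset_sort properties_for_sort sorted_sort)
    finally show "col (Suc i) u = col (Suc i) v \<longleftrightarrow> col i u = col i v \<and>
        image_mset (col i) (mset_set (neighbourhood graph10 u)) =
        image_mset (col i) (mset_set (neighbourhood graph10 v))"
      using uv by (simp add: mset_N)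
  next
    fix u v
    assume "u \<in> pverts graph10" "v \<in> pverts graph10"
    moreover have "colours10 ! 0 = replicate 10 0"
      by code_simp
    ultimately show "col 0 u = col 0 v"
      by (simp add: col_def verts)
  qed (use that in \<open>auto simp: verts\<close>)
  have "long_refinement (Suc (Suc 8)) graph10"
  \<comment> \<open>The vertices 5 and 6 are the only ones sharing a colour in round 8.\<close>
  proof (rule long_refinementI[OF G, where u = 5 and v = 6])
    show "colouring graph10 8 5 = colouring graph10 8 6"
      by (subst eq_iff) (simp_all add: col_def colours10_def)
    show "colouring graph10 (Suc 8) 5 \<noteq> colouring graph10 (Suc 8) 6"
      by (subst eq_iff) (simp_all add: col_def colours10_def)
  qed (simp_all add: verts)
  then show ?thesis
    by simp
qed

lemma residue_mod_6:
  fixes n :: nat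
  assumes "n \<ge> 11"
  obtains L where "0 < L" "n = 6 * L + 5 \<or> n = 6 * L + 6 \<or> n = 6 * L + 7 \<or> n = 6 * L + 8 \<or> n = 6 * L + 9 \<or> n = 6 * L + 10"
proof
  show "0 < (n - 5) div 6"
    using assms by (simp add: div_greater_zero_iff)
  show "n = 6 * ((n - 5) div 6) + 5 \<or> n = 6 * ((n - 5) div 6) + 6 \<or> n = 6 * ((n - 5) div 6) + 7 \<or>
     n = 6 * ((n - 5) div 6) + 8 \<or> n = 6 * ((n - 5) div 6) + 9 \<or> n = 6 * ((n - 5) div 6) + 10"
    using assms by presburger
qed

lemma WL1_max_eq:
  assumes "n \<ge> 10"
  shows "WL1_max n = n - 1"
proof (cases "n = 10")
  case True
  then show ?thesis
    using WL1_max_eqI[OF long_refinement_graph10] by simp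
next
  case False
  with assms have "n \<ge> 11"
    by simp
  then obtain L where L: "0 < L" and n: "n = 6 * L + 5 \<or> n = 6 * L + 6 \<or> n = 6 * L + 7 \<or> n = 6 * L + 8 \<or> n = 6 * L + 9 \<or> n = 6 * L + 10"
    by (rule residue_mod_6)
  have "refinement_family L lo hi" if "lo = 0 \<or> lo = 1" "hi = L \<or> hi = Suc L" for lo hi
    using L that by unfold_locales
  note fam = this[THEN refinement_family.long_refinement_family]
    this[THEN refinement_family.long_refinement_family_add_vertex]
  have "\<exists>G :: vertex pair_pre_digraph. long_refinement n G"
    \<comment> \<open>In this order the six facts give the orders \<open>6 * L + 5\<close> to
      \<open>6 * L + 10\<close>.\<close>
    using n fam(1)[of 1 L] fam(2)[of 1 L] fam(1)[of 1 "Suc L"] fam(1)[of 0 L] fam(2)[of 0 L] fam(1)[of 0 "Suc L"]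
    by (elim disjE) (auto simp: algebra_simps)
  then show ?thesis
    using assms WL1_max_eqI by fastforce
qed

theorem theorem1:
  fixes n :: nat
  assumes "n \<ge> 10"
    and "n = 12 \<or> n mod 18 \<notin> {6, 12}"
  shows "WL1_max n = n - 1"
  using assms(1) by (rule WL1_max_eq)

end
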